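(* Let a group $\mathcal{G}$ act on a space $\mathcal{X}$ from the left, and let $\mathcal{H}$ be a subgroup of $\mathcal{G}$. Suppose that there exists a global cross section $\mathcal{Z}$ for the action of $\mathcal{G}$ on $\mathcal{X}$, with the common isotropy subgroup denoted by $\mathcal{G}_0$ (that is, $\mathcal{G}_z=\mathcal{G}_0$ for all $z\in\mathcal{Z}$). Let $\mathcal{G}'\subset\mathcal{G}$ be a complete set of representatives of the double cosets $\mathcal{H}g\mathcal{G}_0$, $g\in\mathcal{G}$, in $\mathcal{G}$. Then a global cross section $\mathcal{V}\subset\mathcal{G}/\mathcal{G}_0$ exists for the action of $\mathcal{H}$ on $\mathcal{G}/\mathcal{G}_0$ if and only if the subgroups $$\mathcal{H}\cap g'\mathcal{G}_0 g'^{-1},\quad g'\in\mathcal{G}',$$ are all conjugate to one another in $\mathcal{H}$.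
   Context: For a group $G$ acting from the left on a set $X$: the isotropy subgroup at $x$ is $G_x=\{g\in G: gx=x\}$; a cross section is a subset of $X$ that intersects each orbit $Gx$, $x\in X$, exactly once; a global cross section is a cross section all of whose points have the same isotropy subgroup. $\mathcal{G}/\mathcal{G}_0=\{g\mathcal{G}_0: g\in\mathcal{G}\}$ is the left coset space, and $\mathcal{H}$ acts on it by $(h,g\mathcal{G}_0)\mapsto (hg)\mathcal{G}_0$. The double cosets are $\mathcal{H}g\mathcal{G}_0=\{hgg_0: h\in\mathcal{H},\ g_0\in\mathcal{G}_0\}$; a complete set of representatives is a subset $\mathcal{G}'\subset\mathcal{G}$ with $\mathcal{G}=\bigsqcup_{g'\in\mathcal{G}'}\mathcal{H}g'\mathcal{G}_0$ (disjoint union). *)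

theory Defs
  imports "HOL-Algebra.Group_Action" "HOL-Algebra.Left_Coset" "HOL-Library.Disjoint_Sets"
begin

definition cross_section ::
    "[_, 'b set, 'a \<Rightarrow> 'b \<Rightarrow> 'b, 'b set] \<Rightarrow> bool"
  where "cross_section G E \<phi> Z \<longleftrightarrow>
    Z \<subseteq> E \<and> (\<forall>x\<in>E. \<exists>!z. z \<in> Z \<inter> orbit G \<phi> x)"

definition global_cross_section ::
    "[_, 'b set, 'a \<Rightarrow> 'b \<Rightarrow> 'b, 'b set] \<Rightarrow> bool"
  where "global_cross_section G E \<phi> Z \<longleftrightarrow>
    cross_section G E \<phi> Z \<and>
    (\<forall>z\<in>Z. \<forall>w\<in>Z. stabilizer G \<phi> z = stabilizer G \<phi> w)"

text \<open>Like every action in the library, the action by left translation on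
  \<open>lcosets\<^bsub>G\<^esub> K\<close> is an extensional function on its carrier set. The lemma
  \<open>coset_action_l_coset\<close> gives its value on a coset \<open>g <#\<^bsub>G\<^esub> K\<close>.\<close>

definition coset_action ::
    "[_, 'a set, 'a] \<Rightarrow> 'a set \<Rightarrow> 'a set"
  where "coset_action G K h = (\<lambda>C \<in> lcosets\<^bsub>G\<^esub> K. h <#\<^bsub>G\<^esub> C)"

definition double_coset ::
    "[_, 'a set, 'a set, 'a] \<Rightarrow> 'a set"
  where "double_coset G H K g = {h \<otimes>\<^bsub>G\<^esub> g \<otimes>\<^bsub>G\<^esub> k | h k. h \<in> H \<and> k \<in> K}"

definition double_coset_reps ::
    "[_, 'a set, 'a set, 'a set] \<Rightarrow> bool"
  where "double_coset_reps G H K R \<longleftrightarrow>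
    R \<subseteq> carrier G \<and> carrier G = (\<Union>r\<in>R. double_coset G H K r) \<and>
    disjoint_family_on (double_coset G H K) R"

text \<open>The conjugating element is taken from \<open>H\<close>, not from all of \<open>G\<close>.\<close>

definition conjugate_in ::
    "[_, 'a set, 'a set, 'a set] \<Rightarrow> bool"
  where "conjugate_in G H K L \<longleftrightarrow> (\<exists>h\<in>H. L = h <#\<^bsub>G\<^esub> K #>\<^bsub>G\<^esub> inv\<^bsub>G\<^esub> h)"

lemma (in group) coset_action_l_coset:
  assumes "K \<subseteq> carrier G" "h \<in> carrier G" "g \<in> carrier G"
  shows "coset_action G K h (g <# K) = (h \<otimes> g) <# K"
  using assms by (auto simp: coset_action_def LCOSETS_def lcos_m_assoc)

lemma (in group) group_action_coset_action:
  assumes H: "subgroup H G" and K: "K \<subseteq> carrier G"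
  shows "group_action (G\<lparr>carrier := H\<rparr>) (lcosets K) (coset_action G K)"
proof -
  interpret H: group "G\<lparr>carrier := H\<rparr>"
    using H by (rule subgroup_imp_group)
  have HG: "h \<in> carrier G" if "h \<in> H" for h
    using that H by (rule subgroup.mem_carrier[rotated])
  have sub: "C \<subseteq> carrier G" if "C \<in> lcosets K" for C
    using that K by (auto simp: LCOSETS_def l_coset_def)
  have cl: "h <# C \<in> lcosets K" if "h \<in> carrier G" "C \<in> lcosets K" for h C
    using that K by (auto simp: LCOSETS_def lcos_m_assoc)
  have bij: "coset_action G K h \<in> Bij (lcosets K)" if h: "h \<in> carrier G" for h
  proof -
    have "bij_betw (coset_action G K h) (lcosets K) (lcosets K)"
      by (rule bij_betw_byWitness[where f' = "\<lambda>C. inv h <# C"])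
        (use h cl sub in \<open>auto simp: coset_action_def lcos_m_assoc lcos_mult_one\<close>)
    then show ?thesis
      by (simp add: Bij_def coset_action_def)
  qed
  have "coset_action G K (h \<otimes> h') =
      compose (lcosets K) (coset_action G K h) (coset_action G K h')"
    if "h \<in> carrier G" "h' \<in> carrier G" for h h'
    using that cl sub
    by (auto simp: coset_action_def compose_def lcos_m_assoc restrict_def fun_eq_iff)
  then have "coset_action G K \<in> hom (G\<lparr>carrier := H\<rparr>) (BijGroup (lcosets K))"
    using bij HG by (auto simp: hom_def BijGroup_def)
  then show ?thesis
    by (simp add: group_action_def group_hom_def group_hom_axioms_def
        group_BijGroup H.group_axioms)
qed

end

theory Submission
  imports Defs
begin

text \<open>Isotropy groups along an orbit are conjugate, so a cross section \<open>T\<close> can be moved, point by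
  point inside its orbits, to one with constant isotropy if and only if the isotropy groups at the
  points of \<open>T\<close> are conjugate. The \<open>H\<close>-orbits on \<open>G/G\<^sub>0\<close> correspond to the double cosets, hence
  the cosets of double coset representatives form such a \<open>T\<close>, with isotropy groups
  \<open>H \<inter> r G\<^sub>0 r\<^sup>-\<^sup>1\<close>.\<close>

section \<open>Isotropy groups, orbits and cross sections of an arbitrary action\<close>

lemma (in group) mem_conjugate_iff:
  assumes "g \<in> carrier G" "S \<subseteq> carrier G"
  shows "x \<in> g <# S #> inv g \<longleftrightarrow> x \<in> carrier G \<and> inv g \<otimes> x \<otimes> g \<in> S"
proof
  assume "x \<in> g <# S #> inv g"
  then obtain s where s: "s \<in> S" "x = g \<otimes> s \<otimes> inv g"
    by (auto simp: l_coset_def r_coset_def)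
  then have "s \<in> carrier G"
    using assms by blast
  then show "x \<in> carrier G \<and> inv g \<otimes> x \<otimes> g \<in> S"
    using s assms by (simp add: m_assoc) (simp flip: m_assoc)
next
  assume x: "x \<in> carrier G \<and> inv g \<otimes> x \<otimes> g \<in> S"
  then have "x = g \<otimes> (inv g \<otimes> x \<otimes> g) \<otimes> inv g"
    using assms by (simp add: m_assoc) (simp flip: m_assoc)
  then show "x \<in> g <# S #> inv g"
    using x by (auto simp: l_coset_def r_coset_def)
qed

lemma (in group_action) group_G: "group G"
  using group_hom group_hom.axioms(1) by blast

text \<open>An element \<open>a\<close> fixes the image of \<open>x\<close> under \<open>g\<close>
  exactly when \<open>inv g \<otimes> a \<otimes> g\<close> fixes \<open>x\<close>.\<close>

lemma (in group_action) stabilizer_image: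
  assumes "g \<in> carrier G" "x \<in> E"
  shows "stabilizer G \<phi> (\<phi> g x) = g <# stabilizer G \<phi> x #> inv g"
proof -
  interpret group G by (rule group_G)
  have "\<phi> a (\<phi> g x) = \<phi> g x \<longleftrightarrow> \<phi> (inv g \<otimes> a \<otimes> g) x = x" if a: "a \<in> carrier G" for a
  proof -
    have E: "\<phi> g x \<in> E" "\<phi> a (\<phi> g x) \<in> E"
      using assms a element_image by blast+
    have eq: "\<phi> (inv g \<otimes> a \<otimes> g) x = \<phi> (inv g) (\<phi> a (\<phi> g x))"
      using assms a E by (simp add: composition_rule)
    have "\<phi> (inv g) (\<phi> g x) = x"
      using assms orbit_sym_aux by blast
    \<comment> \<open>The injective map \<open>\<phi> (inv g)\<close> is cancelled on both
      sides.\<close>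
    moreover have "\<phi> (inv g) (\<phi> a (\<phi> g x)) = \<phi> (inv g) (\<phi> g x) \<longleftrightarrow> \<phi> a (\<phi> g x) = \<phi> g x"
      using inj_onD[OF inj_prop[of "inv g"]] assms(1) E by auto
    ultimately show ?thesis
      using eq by simp
  qed
  then show ?thesis
    using assms by (auto simp: mem_conjugate_iff stabilizer_subset) (auto simp: stabilizer_def)
qed

lemma (in group_action) orbit_image:
  assumes "g \<in> carrier G" "x \<in> E"
  shows "orbit G \<phi> (\<phi> g x) = orbit G \<phi> x"
proof -
  have y: "\<phi> g x \<in> E"
    using assms element_image by blast
  have o: "\<phi> g x \<in> orbit G \<phi> x"
    using assms by (auto simp: orbit_def)
  have sub: "orbit G \<phi> z \<subseteq> E" if "z \<in> E" for z
    using that element_image by (auto simp: orbit_def)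
  show ?thesis
    using orbit_trans[OF assms(2) y _ o] orbit_trans[OF y assms(2) _ orbit_sym[OF assms(2) y o]]
      sub[OF y] sub[OF assms(2)] by blast
qed

text \<open>Any cross section \<open>T\<close> may serve as reference, so the criterion can later be
  read off at the cosets of double coset representatives.\<close>

lemma (in group_action) ex_global_cross_section_iff:
  assumes T: "cross_section G E \<phi> T"
  shows "(\<exists>V. global_cross_section G E \<phi> V) \<longleftrightarrow>
    (\<forall>x\<in>T. \<forall>y\<in>T. conjugate_in G (carrier G) (stabilizer G \<phi> x) (stabilizer G \<phi> y))"
    (is "?L \<longleftrightarrow> ?R")
proof
  interpret group G by (rule group_G)
  have TE: "x \<in> E" if "x \<in> T" for x
    using T that by (auto simp: cross_section_def)
  {
    assume ?L
    then obtain V where V: "cross_section G E \<phi> V"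
      and st: "\<And>v w. v \<in> V \<Longrightarrow> w \<in> V \<Longrightarrow> stabilizer G \<phi> v = stabilizer G \<phi> w"
      unfolding global_cross_section_def by blast
    have meet: "\<exists>g\<in>carrier G. \<phi> g x \<in> V" if "x \<in> T" for x
      using V TE[OF that] unfolding cross_section_def orbit_def by blast
    show ?R
    proof (intro ballI)
      fix x y assume x: "x \<in> T" and y: "y \<in> T"
      obtain g h where g: "g \<in> carrier G" "\<phi> g x \<in> V" and h: "h \<in> carrier G" "\<phi> h y \<in> V"
        using meet x y by blast
      have hy: "\<phi> h y \<in> E" "\<phi> (inv h) (\<phi> h y) = y"
        using h(1) TE[OF y] element_image orbit_sym_aux by blast+
      \<comment> \<open>The isotropy group of \<open>x\<close> is transported by \<open>g\<close> to
        a point of \<open>V\<close>, where it is the same as at the point reached from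
        \<open>y\<close> by \<open>h\<close>, and then back by \<open>inv h\<close>. In general
        \<open>?k\<close> does not carry \<open>x\<close> to \<open>y\<close>, which lie in
        different orbits if distinct; only the isotropy group at the image of \<open>x\<close> is
        that of \<open>y\<close>.\<close>
      let ?k = "inv h \<otimes> g"
      have k: "?k \<in> carrier G"
        using g h by simp
      have gx: "\<phi> g x \<in> E"
        using g(1) TE[OF x] element_image by blast
      have "stabilizer G \<phi> y = inv h <# stabilizer G \<phi> (\<phi> h y) #> inv (inv h)"
        using stabilizer_image[OF inv_closed[OF h(1)] hy(1)] hy(2) by simp
      also have "\<dots> = inv h <# stabilizer G \<phi> (\<phi> g x) #> inv (inv h)"
        using st[OF h(2) g(2)] by simp
      also have "\<dots> = stabilizer G \<phi> (\<phi> (inv h) (\<phi> g x))"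
        using stabilizer_image[OF inv_closed[OF h(1)] gx] by simp
      also have "\<dots> = stabilizer G \<phi> (\<phi> ?k x)"
        using composition_rule[OF TE[OF x]] g h by simp
      also have "\<dots> = ?k <# stabilizer G \<phi> x #> inv ?k"
        by (rule stabilizer_image[OF k TE[OF x]])
      finally show "conjugate_in G (carrier G) (stabilizer G \<phi> x) (stabilizer G \<phi> y)"
        using k by (auto simp: conjugate_in_def)
    qed
  next
    assume R: ?R
    show ?L
    \<comment> \<open>The construction needs a base point \<open>t\<close>, whose isotropy group
      becomes the common one. Without points in \<open>T\<close> there are no orbits, and the empty
      set is a global cross section.\<close>
    proof (cases "T = {}")
      case True
      then have "global_cross_section G E \<phi> {}"
        using T by (simp add: global_cross_section_def)
      then show ?thesis ..
    next
      case False
      then obtain t where t: "t \<in> T"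
        by blast
      \<comment> \<open>The element that conjugates the isotropy group of \<open>x\<close> into that
        of \<open>t\<close> also moves \<open>x\<close> to the point wanted.\<close>
      have "\<exists>g\<in>carrier G. stabilizer G \<phi> (\<phi> g x) = stabilizer G \<phi> t" if "x \<in> T" for x
        using R that t TE stabilizer_image unfolding conjugate_in_def by metis
      then obtain \<gamma> where \<gamma>: "\<And>x. x \<in> T \<Longrightarrow> \<gamma> x \<in> carrier G"
        and st: "\<And>x. x \<in> T \<Longrightarrow> stabilizer G \<phi> (\<phi> (\<gamma> x) x) = stabilizer G \<phi> t"
        by metis
      let ?V = "(\<lambda>x. \<phi> (\<gamma> x) x) ` T"
      have VE: "?V \<subseteq> E"
        using \<gamma> TE element_image by blast
      have "\<exists>!v. v \<in> ?V \<inter> orbit G \<phi> x" if x: "x \<in> E" for x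
      proof -
        \<comment> \<open>Each point is moved inside its own orbit, so \<open>?V\<close> inherits
          existence and uniqueness from \<open>T\<close>. Symmetry puts the moved point in the place
          where \<open>orbit_image\<close> applies.\<close>
        have orb: "\<phi> (\<gamma> y) y \<in> orbit G \<phi> x \<longleftrightarrow> y \<in> orbit G \<phi> x" if y: "y \<in> T" for y
        proof -
          have "\<phi> (\<gamma> y) y \<in> E"
            using y VE by blast
          then have "\<phi> (\<gamma> y) y \<in> orbit G \<phi> x \<longleftrightarrow> x \<in> orbit G \<phi> (\<phi> (\<gamma> y) y)"
            using x orbit_sym by blast
          also have "\<dots> \<longleftrightarrow> x \<in> orbit G \<phi> y"
            by (simp add: orbit_image[OF \<gamma>[OF y] TE[OF y]])
          also have "\<dots> \<longleftrightarrow> y \<in> orbit G \<phi> x"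
            using x TE[OF y] orbit_sym by blast
          finally show ?thesis .
        qed
        have "\<exists>!y. y \<in> T \<inter> orbit G \<phi> x"
          using T x by (auto simp: cross_section_def)
        then obtain y where y: "y \<in> T" "y \<in> orbit G \<phi> x"
          and uniq: "\<And>y'. y' \<in> T \<Longrightarrow> y' \<in> orbit G \<phi> x \<Longrightarrow> y' = y"
          by blast
        show ?thesis
        proof (rule ex1I)
          show "\<phi> (\<gamma> y) y \<in> ?V \<inter> orbit G \<phi> x"
            using y orb by blast
        next
          fix v assume "v \<in> ?V \<inter> orbit G \<phi> x"
          then obtain y' where "y' \<in> T" "v = \<phi> (\<gamma> y') y'" "y' \<in> orbit G \<phi> x"
            using orb by blast
          then show "v = \<phi> (\<gamma> y) y"
            using uniq by blast
        qed
      qed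
      then have "cross_section G E \<phi> ?V"
        using VE by (simp add: cross_section_def)
      then have "global_cross_section G E \<phi> ?V"
        using st by (auto simp: global_cross_section_def)
      then show ?thesis ..
    qed
  }
qed

section \<open>The action of a subgroup on left cosets\<close>

lemma (in group) l_coset_eq_iff:
  assumes K: "subgroup K G" and g: "g \<in> carrier G" and a: "a \<in> carrier G"
  shows "g <# K = a <# K \<longleftrightarrow> inv a \<otimes> g \<in> K"
proof
  assume "g <# K = a <# K"
  then have "g \<in> a <# K"
    using lcos_self[OF g K] by simp
  then show "inv a \<otimes> g \<in> K"
    using subgroup.lcos_module_imp[OF K is_group a] by blast
next
  assume "inv a \<otimes> g \<in> K"
  then have "g \<in> a <# K"
    using subgroup.lcos_module_rev[OF K is_group a g] by blast
  then show "g <# K = a <# K"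
    using l_repr_independence[OF _ a K] by simp
qed

text \<open>For \<open>h\<close> in \<open>H\<close>, both fixing the coset of \<open>g\<close> and
  lying in the conjugate amount to \<open>inv g \<otimes> h \<otimes> g \<in> K\<close>.\<close>

lemma (in group) stabilizer_coset_action:
  assumes H: "subgroup H G" and K: "subgroup K G" and g: "g \<in> carrier G"
  shows "stabilizer (G\<lparr>carrier := H\<rparr>) (coset_action G K) (g <# K) = H \<inter> (g <# K #> inv g)"
proof -
  have KG: "K \<subseteq> carrier G" and HG: "H \<subseteq> carrier G"
    using K H subgroup.subset by blast+
  have "coset_action G K h (g <# K) = g <# K \<longleftrightarrow> h \<in> g <# K #> inv g" if "h \<in> H" for h
  proof -
    have h: "h \<in> carrier G"
      using that HG by blast
    then show ?thesis
      using g KG by (simp add: coset_action_l_coset l_coset_eq_iff[OF K] mem_conjugate_iff m_assoc)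
  qed
  then show ?thesis
    by (auto simp: stabilizer_def)
qed

lemma (in group) l_coset_in_orbit_iff:
  assumes H: "subgroup H G" and K: "subgroup K G" and g: "g \<in> carrier G" and a: "a \<in> carrier G"
  shows "g <# K \<in> orbit (G\<lparr>carrier := H\<rparr>) (coset_action G K) (a <# K) \<longleftrightarrow>
    g \<in> double_coset G H K a"
proof -
  have KG: "K \<subseteq> carrier G" and HG: "H \<subseteq> carrier G"
    using K H subgroup.subset by blast+
  have "g <# K = coset_action G K h (a <# K) \<longleftrightarrow> (\<exists>k\<in>K. g = h \<otimes> a \<otimes> k)" if "h \<in> H" for h
  proof -
    have h: "h \<in> carrier G"
      using that HG by blast
    then have "g <# K = coset_action G K h (a <# K) \<longleftrightarrow> g <# K = (h \<otimes> a) <# K"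
      using KG a by (simp add: coset_action_l_coset)
    \<comment> \<open>A left coset is determined by any of its elements.\<close>
    also have "\<dots> \<longleftrightarrow> g \<in> (h \<otimes> a) <# K"
      using lcos_self[OF g K] l_repr_independence[OF _ _ K] a h by blast
    finally show ?thesis
      by (auto simp: l_coset_def)
  qed
  then have "(\<exists>h\<in>H. g <# K = coset_action G K h (a <# K)) \<longleftrightarrow>
      (\<exists>h\<in>H. \<exists>k\<in>K. g = h \<otimes> a \<otimes> k)"
    by (rule bex_cong[OF refl])
  then show ?thesis
    unfolding orbit_def double_coset_def by simp blast
qed

text \<open>The orbit of the coset of \<open>g\<close> contains the coset of \<open>r\<close>
  exactly when \<open>g\<close> lies in the double coset of \<open>r\<close>. That the double cosets
  cover the group gives existence, their disjointness uniqueness.\<close>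

lemma (in group) cross_section_double_coset_reps:
  assumes H: "subgroup H G" and K: "subgroup K G" and R: "double_coset_reps G H K R"
  shows "cross_section (G\<lparr>carrier := H\<rparr>) (lcosets K) (coset_action G K) ((\<lambda>r. r <# K) ` R)"
proof -
  let ?orb = "orbit (G\<lparr>carrier := H\<rparr>) (coset_action G K)"
  have KG: "K \<subseteq> carrier G"
    using K by (rule subgroup.subset)
  interpret A: group_action "G\<lparr>carrier := H\<rparr>" "lcosets K" "coset_action G K"
    by (rule group_action_coset_action[OF H KG])
  have RG: "r \<in> carrier G" if "r \<in> R" for r
    using R that by (auto simp: double_coset_reps_def)
  have coset: "g <# K \<in> lcosets K" if "g \<in> carrier G" for g
    using that by (auto simp: LCOSETS_def)
  have ex1: "\<exists>!C. C \<in> (\<lambda>r. r <# K) ` R \<inter> ?orb (g <# K)" if g: "g \<in> carrier G" for g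
  proof -
    have orb: "r <# K \<in> ?orb (g <# K) \<longleftrightarrow> g \<in> double_coset G H K r" if r: "r \<in> R" for r
      using A.orbit_sym coset[OF g] coset[OF RG[OF r]] l_coset_in_orbit_iff[OF H K g RG[OF r]]
      by blast
    obtain r where r: "r \<in> R" "g \<in> double_coset G H K r"
      using R g by (auto simp: double_coset_reps_def)
    have uniq: "s = r" if "s \<in> R" "g \<in> double_coset G H K s" for s
      using R r that unfolding double_coset_reps_def disjoint_family_on_def by blast
    show ?thesis
    proof (rule ex1I)
      show "r <# K \<in> (\<lambda>r. r <# K) ` R \<inter> ?orb (g <# K)"
        using r orb by blast
    next
      fix C assume "C \<in> (\<lambda>r. r <# K) ` R \<inter> ?orb (g <# K)"
      then obtain s where "s \<in> R" "C = s <# K" "g \<in> double_coset G H K s"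
        using orb by blast
      then show "C = r <# K"
        using uniq by blast
    qed
  qed
  have "\<exists>!C. C \<in> (\<lambda>r. r <# K) ` R \<inter> ?orb D" if D: "D \<in> lcosets K" for D
  proof -
    obtain g where "g \<in> carrier G" "D = g <# K"
      using D by (auto simp: LCOSETS_def)
    then show ?thesis
      using ex1 by simp
  qed
  then show ?thesis
    using RG coset by (auto simp: cross_section_def)
qed

text \<open>The criterion for the restricted action speaks of inverses taken in the group with
  carrier \<open>H\<close>; on \<open>H\<close> they agree with those of \<open>G\<close>.\<close>

lemma (in group) conjugate_in_subgroup:
  assumes "subgroup H G"
  shows "conjugate_in (G\<lparr>carrier := H\<rparr>) H A B \<longleftrightarrow> conjugate_in G H A B"
  using m_inv_consistent[OF assms] by (simp add: conjugate_in_def l_coset_def r_coset_def)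

theorem theorem3p1:
  fixes G :: "('g, 'm) monoid_scheme" (structure)
    and X :: "'x set" and \<phi> :: "'g \<Rightarrow> 'x \<Rightarrow> 'x"
    and H G\<^sub>0 R :: "'g set" and Z :: "'x set"
  assumes "group_action G X \<phi>"
    and "subgroup H G"
    and "global_cross_section G X \<phi> Z"
    and "subgroup G\<^sub>0 G" and "\<And>z. z \<in> Z \<Longrightarrow> stabilizer G \<phi> z = G\<^sub>0"
    and "double_coset_reps G H G\<^sub>0 R"
  shows "(\<exists>V. global_cross_section (G\<lparr>carrier := H\<rparr>) (lcosets G\<^sub>0) (coset_action G G\<^sub>0) V)
    \<longleftrightarrow> (\<forall>r\<in>R. \<forall>s\<in>R.
          conjugate_in G H (H \<inter> (r <# G\<^sub>0 #> inv r)) (H \<inter> (s <# G\<^sub>0 #> inv s)))"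
proof -
  interpret group G
    using assms(1) by (rule group_action.group_G)
  interpret A: group_action "G\<lparr>carrier := H\<rparr>" "lcosets G\<^sub>0" "coset_action G G\<^sub>0"
    by (rule group_action_coset_action[OF assms(2) subgroup.subset[OF assms(4)]])
  have RG: "r \<in> carrier G" if "r \<in> R" for r
    using assms(6) that by (auto simp: double_coset_reps_def)
  show ?thesis
    \<comment> \<open>The reference cross section is the image of \<open>R\<close> under
      \<open>r \<mapsto> r <# G\<^sub>0\<close>, so quantifiers over its points become quantifiers
      over \<open>R\<close>.\<close>
    using A.ex_global_cross_section_iff
        [OF cross_section_double_coset_reps[OF assms(2) assms(4) assms(6)]] RG
    by (simp add: stabilizer_coset_action[OF assms(2) assms(4)] conjugate_in_subgroup[OF assms(2)])
qed

end
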